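(* Let $d\ge1$, $b>0$, $0<y_1<\cdots<y_d<b$, and $a_0,\dots,a_d>0$, and let $\zeta$ be the restriction to $[0,b]$ of the step function $$\tilde\zeta=a_0\chi_{(-\infty,y_1)}+\Bigl(\sum_{j=1}^{d-1}a_j\chi_{[y_j,y_{j+1})}\Bigr)+a_d\chi_{[y_d,\infty)}.$$ For $0\ne\omega\in\mathbb{R}$ let $u$ be the solution on $[0,b]$ of $$(\zeta u')'+\omega^2\zeta u=0,\qquad \tfrac12\bigl(u(0)+\tfrac{1}{i\omega}u'(0)\bigr)=1,\qquad \tfrac12\bigl(u(b)-\tfrac{1}{i\omega}u'(b)\bigr)=0,$$ and let $R(\omega)=\tfrac12\bigl(u(0)-\tfrac1{i\omega}u'(0)\bigr)$ be the corresponding reflection coefficient. Set $$r_j=\frac{a_{j-1}-a_j}{a_{j-1}+a_j}\qquad(1\le j\le d).$$ Then $$\lim_{L\to\infty}\frac{1}{2L}\int_{-L}^L\log(1-|R(\omega)|^2)\,d\omega=\sum_{j=1}^d\log(1-|r_j|^2).$$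
   Context: $\chi_I$ denotes the indicator function of the set $I$. The differential equation (the Schr\"odinger equation in impedance form) with piecewise constant $\zeta$ is understood in the usual weak sense: $u$ and $\zeta u'$ are continuous on $[0,b]$ and the equation $u''+\omega^2u=0$ holds on each interval where $\zeta$ is constant. *)

theory Defs
  imports "HOL-Analysis.Analysis"
begin

definition step_impedance :: "nat \<Rightarrow> (nat \<Rightarrow> real) \<Rightarrow> (nat \<Rightarrow> real) \<Rightarrow> real \<Rightarrow> real" where
  "step_impedance d y a x =
     a 0 * indicat_real {..<y 1} x
     + (\<Sum>j\<in>{1..<d}. a j * indicat_real {y j..<y (j + 1)} x)
     + a d * indicat_real {y d..} x"

text \<open>
  Weak solutions of \<open>(\<zeta> u')' + \<omega>\<^sup>2 \<zeta> u = 0\<close> on \<open>[0,b]\<close> for piecewise constant \<open>\<zeta>\<close>.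
  As \<open>u'\<close> need not exist at a jump of \<open>\<zeta>\<close>, continuity of \<open>\<zeta> u'\<close> on \<open>[0,b]\<close> means that
  \<open>\<zeta> u'\<close>, given on the open intervals where \<open>\<zeta>\<close> is constant, extends to a function \<open>p\<close>
  continuous on \<open>[0,b]\<close>.  Only the values of \<open>\<zeta>\<close> and \<open>u\<close> on \<open>[0,b]\<close> matter.
\<close>

definition impedance_solution ::
  "real \<Rightarrow> (real \<Rightarrow> real) \<Rightarrow> real \<Rightarrow> (real \<Rightarrow> complex) \<Rightarrow> bool" where
  "impedance_solution b \<zeta> \<omega> u \<longleftrightarrow>
     continuous_on {0..b} u \<and>
     (\<exists>p. continuous_on {0..b} p \<and>
       (\<forall>s t. 0 \<le> s \<and> s < t \<and> t \<le> b \<and> \<zeta> constant_on {s<..<t} \<longrightarrow>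
         (\<forall>x\<in>{s<..<t}.
            u differentiable (at x) \<and>
            p x = of_real (\<zeta> x) * vector_derivative u (at x) \<and>
            (\<lambda>z. vector_derivative u (at z)) differentiable (at x) \<and>
            vector_derivative (\<lambda>z. vector_derivative u (at z)) (at x)
              + of_real (\<omega>\<^sup>2) * u x = 0)))"

text \<open>
  At the end points \<open>u'\<close> is the one-sided derivative.  Membership in \<open>extensional {0..b}\<close>
  makes \<open>u\<close> a function on \<open>[0,b]\<close>, so that the solution is unique.
\<close>

definition scattering_solution ::
  "real \<Rightarrow> (real \<Rightarrow> real) \<Rightarrow> real \<Rightarrow> real \<Rightarrow> complex" where
  "scattering_solution b \<zeta> \<omega> =
     (THE u. u \<in> extensional {0..b} \<and>
        impedance_solution b \<zeta> \<omega> u \<and>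
        1 / 2 * (u 0 + 1 / (\<i> * of_real \<omega>) * vector_derivative u (at 0 within {0..b})) = 1 \<and>
        1 / 2 * (u b - 1 / (\<i> * of_real \<omega>) * vector_derivative u (at b within {0..b})) = 0)"

text \<open>Meaningful for \<open>\<omega> \<noteq> 0\<close> only.\<close>

definition reflection_coefficient :: "real \<Rightarrow> (real \<Rightarrow> real) \<Rightarrow> real \<Rightarrow> complex" where
  "reflection_coefficient b \<zeta> \<omega> =
     (let u = scattering_solution b \<zeta> \<omega>
      in 1 / 2 * (u 0 - 1 / (\<i> * of_real \<omega>) * vector_derivative u (at 0 within {0..b})))"

end

theory Submission
  imports Defs
begin

text \<open>
  On the \<open>j\<close>-th layer a solution is a sum \<open>A\<^sub>j e\<^bsup>i\<omega>x\<^esup> + B\<^sub>j e\<^bsup>-i\<omega>x\<^esup>\<close> of a right- and a left-moving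
  wave, and continuity of \<open>u\<close> and \<open>\<zeta>u'\<close> at the interface \<open>y\<^sub>j\<close> is a linear relation between
  neighbouring pairs of amplitudes, with coefficients \<open>r\<^sub>j\<close> and \<open>e\<^bsup>\<plusminus>2i\<omega>y\<^sub>j\<^esup>\<close>.  In terms of the ratios
  \<open>G\<^sub>j = B\<^sub>j / A\<^sub>j\<close>, which are the reflection coefficients of the part of the medium to the right of
  \<open>y\<^sub>j\<close>, and of the phase-shifted ratios \<open>\<rho>\<^sub>j = e\<^bsup>-2i\<omega>y\<^sub>j\<^esup> G\<^sub>j\<close> (the echoes, seen from \<open>y\<^sub>j\<close>), this
  relation is the Moebius recursion
  \<open>G\<^sub>j\<^sub>-\<^sub>1 = e\<^bsup>2i\<omega>y\<^sub>j\<^esup> (r\<^sub>j + \<rho>\<^sub>j) / (1 + r\<^sub>j \<rho>\<^sub>j)\<close>, which starts from \<open>G\<^sub>d = 0\<close>, the absence of a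
  wave coming in from the right, and ends with \<open>G\<^sub>0 = R\<close>.

  The defect identity \<open>|1 + r\<rho>|\<^sup>2 - |r + \<rho>|\<^sup>2 = (1 - r\<^sup>2)(1 - |\<rho>|\<^sup>2)\<close> turns the recursion into a product,
  \<open>1 - |R|\<^sup>2 = \<Prod> (1 - r\<^sub>j\<^sup>2) / |1 + r\<^sub>j \<rho>\<^sub>j|\<^sup>2\<close>, so that
  \<open>log (1 - |R|\<^sup>2) = \<Sum> log (1 - r\<^sub>j\<^sup>2) - 2 Re \<Sum> Log (1 + r\<^sub>j \<rho>\<^sub>j)\<close>
  (\<open>log_transmission\<close>).  It remains to see that the last sum has mean value zero over the real
  line.  The reason is that an echo needs a positive time to travel across a layer and back:
  each \<open>\<rho>\<^sub>j\<close> is a uniform limit of linear combinations of \<open>e\<^bsup>i\<mu>\<omega>\<^esup>\<close> with \<open>\<mu> > 0\<close>.  Such functions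
  form an algebra closed under uniform limits and under power series without constant term, hence
  they include \<open>Log (1 + r\<^sub>j \<rho>\<^sub>j)\<close> (\<open>positive_spectrum_Ln\<close>, \<open>positive_spectrum_echo\<close>), and each of them
  has mean zero because \<open>e\<^bsup>i\<mu>\<omega>\<^esup>\<close> has (\<open>positive_spectrum_mean_zero\<close>).

  What remains is to identify \<open>R\<close> with \<open>G\<^sub>0\<close>: existence and uniqueness of the scattering solution
  (\<open>scattering_solution_eq\<close>).  Uniqueness comes from solving the equation on each layer and the
  recursion for the amplitudes; existence from gluing the waves with these amplitudes.
\<close>

section \<open>Almost periodic functions with positive frequencies\<close>

text \<open>
  The almost periodic functions on the real line whose frequencies are all positive: the uniform
  closure of the span of \<open>e\<^bsup>i\<mu>\<omega>\<^esup>\<close>, \<open>\<mu> > 0\<close>.  They play the part that bounded analytic functions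
  vanishing at \<open>i\<infinity>\<close> would play in a proof with Jensen's formula in the upper half-plane.
\<close>

inductive positive_spectrum :: "(real \<Rightarrow> complex) \<Rightarrow> bool" where
  exponential: "\<mu> > 0 \<Longrightarrow> positive_spectrum (\<lambda>\<omega>. c * cis (\<mu> * \<omega>))"
| add: "positive_spectrum f \<Longrightarrow> positive_spectrum g \<Longrightarrow> positive_spectrum (\<lambda>\<omega>. f \<omega> + g \<omega>)"
| limit: "(\<And>n. positive_spectrum (F n)) \<Longrightarrow> uniform_limit UNIV F f sequentially \<Longrightarrow> positive_spectrum f"

lemma positive_spectrum_continuous: "positive_spectrum f \<Longrightarrow> continuous_on UNIV f"
proof (induction rule: positive_spectrum.induct)
  case (limit F f)
  then show ?case
    by (intro uniform_limit_theorem[of UNIV F sequentially f]) auto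
qed (auto intro!: continuous_intros)

lemma positive_spectrum_bounded: "positive_spectrum f \<Longrightarrow> bounded (range f)"
proof (induction rule: positive_spectrum.induct)
  case (exponential \<mu> c)
  then show ?case by (auto simp: bounded_iff norm_mult)
next
  case (add f g)
  then show ?case using bounded_plus_comp[of f UNIV g] by simp
next
  case (limit F f)
  then show ?case using uniform_limit_bounded[of F UNIV f sequentially] by auto
qed

lemma positive_spectrum_0: "positive_spectrum (\<lambda>\<omega>. 0)"
  using positive_spectrum.exponential[of 1 0] by simp

lemma positive_spectrum_sum:
  "(\<And>i. i \<in> I \<Longrightarrow> positive_spectrum (f i)) \<Longrightarrow> positive_spectrum (\<lambda>\<omega>. \<Sum>i\<in>I. f i \<omega>)"
proof (induction I rule: infinite_finite_induct)
  case (insert i I)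
  then show ?case using positive_spectrum.add[of "f i" "\<lambda>\<omega>. \<Sum>i\<in>I. f i \<omega>"] by simp
qed (simp_all add: positive_spectrum_0)

lemma uniform_limit_mult_bounded:
  fixes f g :: "real \<Rightarrow> complex"
  assumes "uniform_limit UNIV F f sequentially" "bounded (range f)" "bounded (range g)"
  shows "uniform_limit UNIV (\<lambda>n \<omega>. g \<omega> * F n \<omega>) (\<lambda>\<omega>. g \<omega> * f \<omega>) sequentially"
  using uniform_lim_mult[of "\<lambda>_. g" UNIV g sequentially F f] assms
  by (simp add: uniform_limit_const)

text \<open>
  Multiplication by \<open>e\<^bsup>i\<mu>\<omega>\<^esup>\<close> only shifts frequencies to the right.  The constant \<open>c\<close>, with \<open>\<mu> = 0\<close>,
  also gives closure under scalar multiples.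
\<close>

lemma positive_spectrum_modulate:
  assumes "positive_spectrum f" "\<mu> \<ge> 0"
  shows "positive_spectrum (\<lambda>\<omega>. c * cis (\<mu> * \<omega>) * f \<omega>)"
  using assms(1)
proof (induction rule: positive_spectrum.induct)
  case (exponential \<nu> c')
  have "(\<lambda>\<omega>. c * cis (\<mu> * \<omega>) * (c' * cis (\<nu> * \<omega>))) = (\<lambda>\<omega>. (c * c') * cis ((\<mu> + \<nu>) * \<omega>))"
    by (simp add: fun_eq_iff cis_mult[symmetric] distrib_right)
  with positive_spectrum.exponential[of "\<mu> + \<nu>" "c * c'"] exponential assms(2) show ?case by simp
next
  case (add f g)
  show ?case using positive_spectrum.add[OF add.IH] by (simp add: distrib_left)
next
  case (limit F f)
  have "bounded (range (\<lambda>\<omega>. c * cis (\<mu> * \<omega>)))" by (auto simp: bounded_iff norm_mult)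
  moreover have "bounded (range f)"
    by (rule positive_spectrum_bounded, rule positive_spectrum.limit) (use limit in auto)
  ultimately show ?case
    by (intro positive_spectrum.limit[OF limit.IH uniform_limit_mult_bounded[OF limit.hyps(2)]])
qed

lemma positive_spectrum_cmult:
  "positive_spectrum f \<Longrightarrow> positive_spectrum (\<lambda>\<omega>. c * f \<omega>)"
  using positive_spectrum_modulate[of f 0 c] by simp

text \<open>
  Sums of positive frequencies are positive.  For an exponential factor this is a shift of
  frequencies, and boundedness of the other factor carries it through uniform limits.
\<close>

lemma positive_spectrum_mult:
  assumes "positive_spectrum g" "positive_spectrum f"
  shows "positive_spectrum (\<lambda>\<omega>. f \<omega> * g \<omega>)"
  using assms(1)
proof (induction rule: positive_spectrum.induct)
  case (exponential \<mu> c)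
  then show ?case using positive_spectrum_modulate[OF assms(2), of \<mu> c] by (simp add: mult.commute)
next
  case (add g g')
  show ?case using positive_spectrum.add[OF add.IH] by (simp add: distrib_left)
next
  case (limit F g)
  have "bounded (range g)"
    by (rule positive_spectrum_bounded, rule positive_spectrum.limit) (use limit in auto)
  then show ?case using positive_spectrum_bounded[OF assms(2)]
    by (intro positive_spectrum.limit[OF limit.IH uniform_limit_mult_bounded[OF limit.hyps(2)]])
qed

lemma positive_spectrum_power:
  assumes "positive_spectrum f" "n > 0"
  shows "positive_spectrum (\<lambda>\<omega>. f \<omega> ^ n)"
  using assms(2)
proof (induction n rule: nat_induct_non_zero)
  case (Suc n)
  then show ?case using positive_spectrum_mult[OF Suc.IH assms(1)] by simp
qed (simp add: assms(1))

text \<open>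
  The constant term must vanish because a nonzero constant has frequency \<open>0\<close>; absolute summability
  of the coefficients makes the partial sums converge uniformly.
\<close>

lemma positive_spectrum_power_series:
  assumes f: "positive_spectrum f" "\<And>\<omega>. cmod (f \<omega>) \<le> 1"
    and c: "c 0 = 0" "summable (\<lambda>n. cmod (c n))"
  shows "positive_spectrum (\<lambda>\<omega>. \<Sum>n. c n * f \<omega> ^ n)"
proof (rule positive_spectrum.limit)
  show "uniform_limit UNIV (\<lambda>n \<omega>. \<Sum>i<n. c i * f \<omega> ^ i) (\<lambda>\<omega>. \<Sum>n. c n * f \<omega> ^ n) sequentially"
  proof (rule Weierstrass_m_test[OF _ c(2)])
    fix n \<omega>
    have "cmod (f \<omega>) ^ n \<le> 1" using f(2) by (intro power_le_one) auto
    then show "cmod (c n * f \<omega> ^ n) \<le> cmod (c n)"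
      by (simp add: norm_mult norm_power mult_left_le)
  qed
  fix n
  show "positive_spectrum (\<lambda>\<omega>. \<Sum>i<n. c i * f \<omega> ^ i)"
  proof (rule positive_spectrum_sum)
    fix i
    show "positive_spectrum (\<lambda>\<omega>. c i * f \<omega> ^ i)"
    proof (cases "i = 0")
      case True then show ?thesis by (simp add: c positive_spectrum_0)
    next
      case False then show ?thesis by (intro positive_spectrum_cmult positive_spectrum_power f) auto
    qed
  qed
qed

text \<open>
  Expanding the geometric series leaves only powers \<open>f\<^sup>n\<close> with \<open>n \<ge> 1\<close>.  This is the nonconstant part
  of \<open>(r + f) / (1 + r f) = r + (1 - r\<^sup>2) f / (1 + r f)\<close>.
\<close>

lemma positive_spectrum_Mobius:
  fixes r :: real
  assumes f: "positive_spectrum f" "\<And>\<omega>. cmod (f \<omega>) \<le> 1" and r: "\<bar>r\<bar> < 1"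
  shows "positive_spectrum (\<lambda>\<omega>. f \<omega> / (1 + of_real r * f \<omega>))"
proof -
  define c where "c n = (if n = 0 then 0 else (- of_real r) ^ (n - 1) :: complex)" for n
  have "positive_spectrum (\<lambda>\<omega>. \<Sum>n. c n * f \<omega> ^ n)"
  proof (rule positive_spectrum_power_series[OF f])
    have "summable (\<lambda>n. cmod (c (Suc n)))"
      using r by (simp add: c_def norm_power summable_geometric)
    then show "summable (\<lambda>n. cmod (c n))" using summable_Suc_iff[of "\<lambda>n. cmod (c n)"] by simp
  qed (simp_all add: c_def)
  moreover have "(\<Sum>n. c n * f \<omega> ^ n) = f \<omega> / (1 + of_real r * f \<omega>)" for \<omega>
  proof -
    have "cmod (- of_real r * f \<omega>) < 1"
      using f(2)[of \<omega>] r by (simp add: norm_mult) (meson abs_ge_zero mult_left_le order_le_less_trans)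
    then have "(\<lambda>n. f \<omega> * (- of_real r * f \<omega>) ^ n) sums (f \<omega> * (1 / (1 - (- of_real r * f \<omega>))))"
      by (intro sums_mult geometric_sums)
    moreover have "f \<omega> * (- of_real r * f \<omega>) ^ n = c (Suc n) * f \<omega> ^ Suc n" for n
      unfolding c_def power_mult_distrib by simp
    ultimately have "(\<lambda>n. c (Suc n) * f \<omega> ^ Suc n) sums (f \<omega> / (1 + of_real r * f \<omega>))"
      by (simp del: power_Suc)
    then have "(\<lambda>n. c n * f \<omega> ^ n) sums (f \<omega> / (1 + of_real r * f \<omega>) + c 0 * f \<omega> ^ 0)"
      by (rule sums_Suc)
    then show ?thesis by (simp add: c_def sums_iff)
  qed
  ultimately show ?thesis by simp
qed

text \<open>
  The logarithmic series has no constant term, and its coefficients are dominated by \<open>|r|\<^sup>n\<close>.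
\<close>

lemma positive_spectrum_Ln:
  fixes r :: real
  assumes f: "positive_spectrum f" "\<And>\<omega>. cmod (f \<omega>) \<le> 1" and r: "\<bar>r\<bar> < 1"
  shows "positive_spectrum (\<lambda>\<omega>. Ln (1 + of_real r * f \<omega>))"
proof -
  define c where "c n = (- ((- of_real r) ^ n) / of_nat n :: complex)" for n
  have "positive_spectrum (\<lambda>\<omega>. \<Sum>n. c n * f \<omega> ^ n)"
  proof (rule positive_spectrum_power_series[OF f])
    have "norm (cmod (c n)) \<le> \<bar>r\<bar> ^ n" for n
    proof (cases "n = 0")
      case False
      then have "\<bar>r\<bar> ^ n / real n \<le> \<bar>r\<bar> ^ n / 1" by (intro divide_left_mono) auto
      then show ?thesis by (simp add: c_def norm_divide norm_power)
    qed (simp add: c_def)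
    moreover have "summable (\<lambda>n. \<bar>r\<bar> ^ n)" using r by (simp add: summable_geometric)
    ultimately show "summable (\<lambda>n. cmod (c n))"
      using summable_comparison_test'[of "\<lambda>n. \<bar>r\<bar> ^ n" 0 "\<lambda>n. cmod (c n)"] by blast
  qed (simp_all add: c_def)
  moreover have "(\<Sum>n. c n * f \<omega> ^ n) = Ln (1 + of_real r * f \<omega>)" for \<omega>
  proof -
    have "cmod (of_real r * f \<omega>) < 1"
      using f(2)[of \<omega>] r by (simp add: norm_mult) (meson abs_ge_zero mult_left_le order_le_less_trans)
    from Ln_series'[OF this]
    have "(\<lambda>n. - ((- (of_real r * f \<omega>)) ^ n) / of_nat n) sums Ln (1 + of_real r * f \<omega>)" .
    moreover have "- ((- (of_real r * f \<omega>)) ^ n) / of_nat n = c n * f \<omega> ^ n" for n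
    proof -
      have "(- (of_real r * f \<omega>)) ^ n = (- of_real r) ^ n * f \<omega> ^ n"
        by (simp flip: power_mult_distrib)
      then show ?thesis by (simp add: c_def)
    qed
    ultimately show ?thesis by (simp add: sums_iff)
  qed
  ultimately show ?thesis by simp
qed

section \<open>Mean values\<close>

lemma continuous_set_integrable_Icc:
  fixes f :: "real \<Rightarrow> 'a::{banach, second_countable_topology}"
  assumes "continuous_on UNIV f"
  shows "set_integrable lborel {a..b} f"
  using assms by (intro borel_integrable_atLeastAtMost') (auto intro: continuous_on_subset)

lemma norm_integral_Icc_le:
  fixes f :: "real \<Rightarrow> complex"
  assumes "continuous_on UNIV f" "L > 0" "\<And>x. norm (f x) \<le> e"
  shows "norm (LINT x:{-L..L}|lborel. f x) \<le> 2 * L * e"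
proof -
  have "norm (LINT x:{-L..L}|lborel. f x) \<le> (LINT x:{-L..L}|lborel. norm (f x))"
    by (rule set_integral_norm_bound[OF continuous_set_integrable_Icc[OF assms(1)]])
  also have "\<dots> \<le> (LINT x:{-L..L}|lborel. e)"
    by (intro set_integral_mono continuous_set_integrable_Icc continuous_intros assms)
  also have "\<dots> = 2 * L * e"
    using assms(2) by (simp add: set_lebesgue_integral_def)
  finally show ?thesis .
qed

text \<open>
  The Bohr mean value, over the symmetric intervals \<open>[-L, L]\<close>.
\<close>

definition has_mean :: "(real \<Rightarrow> 'a::{banach, second_countable_topology}) \<Rightarrow> 'a \<Rightarrow> bool" where
  "has_mean f m \<longleftrightarrow> ((\<lambda>L. (1 / (2 * L)) *\<^sub>R (LINT x:{-L..L}|lborel. f x)) \<longlongrightarrow> m) at_top"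

lemma cis_has_vector_derivative:
  "((\<lambda>x. cis (\<mu> * x)) has_vector_derivative \<i> * of_real \<mu> * cis (\<mu> * x)) (at x within S)"
  unfolding has_vector_derivative_def
  by (rule derivative_eq_intros refl)+ (auto simp: scaleR_conv_of_real)

text \<open>
  The integral over \<open>[-L, L]\<close> stays bounded by \<open>2 |c| / \<mu>\<close>, so dividing by \<open>2 L\<close> makes it vanish.
\<close>

lemma has_mean_exponential:
  assumes "\<mu> > 0"
  shows "has_mean (\<lambda>\<omega>. c * cis (\<mu> * \<omega>)) 0"
proof -
  define E where "E x = (c / (\<i> * of_real \<mu>)) * cis (\<mu> * x)" for x
  have E: "(E has_vector_derivative c * cis (\<mu> * x)) (at x within S)" for x S
    unfolding E_def using assms
      has_vector_derivative_mult_right[OF cis_has_vector_derivative[of \<mu> x S], of "c / (\<i> * of_real \<mu>)"]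
    by simp
  have int: "(LINT x:{-L..L}|lborel. c * cis (\<mu> * x)) = E L - E (-L)" if "L > 0" for L
    unfolding set_lebesgue_integral_def using that
    by (intro integral_FTC_Icc E) (auto intro!: continuous_intros)
  have bound: "cmod ((1 / (2 * L)) *\<^sub>R (E L - E (-L))) \<le> (cmod c / \<mu>) * inverse L" if "L > 0" for L
  proof -
    have "cmod (E L - E (-L)) \<le> cmod (E L) + cmod (E (-L))" by (rule norm_triangle_ineq4)
    also have "\<dots> = 2 * (cmod c / \<mu>)" using assms by (simp add: E_def norm_mult norm_divide)
    finally have "cmod (E L - E (-L)) \<le> 2 * (cmod c / \<mu>)" .
    then have "(1 / (2 * L)) * cmod (E L - E (-L)) \<le> (1 / (2 * L)) * (2 * (cmod c / \<mu>))"
      using that by (intro mult_left_mono) auto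
    also have "\<dots> = (cmod c / \<mu>) * inverse L" using that assms by (simp add: field_simps)
    finally show ?thesis unfolding norm_scaleR using that by simp
  qed
  have "((\<lambda>L. (cmod c / \<mu>) * inverse L) \<longlongrightarrow> 0) at_top"
    by (intro tendsto_mult_right_zero tendsto_inverse_0_at_top filterlim_ident)
  then have "((\<lambda>L. (1 / (2 * L)) *\<^sub>R (E L - E (-L))) \<longlongrightarrow> 0) at_top"
    by (rule Lim_null_comparison[rotated])
      (use bound in \<open>auto intro: eventually_mono[OF eventually_gt_at_top[of 0]]\<close>)
  then show ?thesis unfolding has_mean_def
    by (rule Lim_transform_eventually)
      (use int in \<open>auto intro: eventually_mono[OF eventually_gt_at_top[of 0]]\<close>)
qed

lemma has_mean_add:
  assumes "has_mean f m" "has_mean g n" "continuous_on UNIV f" "continuous_on UNIV g"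
  shows "has_mean (\<lambda>\<omega>. f \<omega> + g \<omega>) (m + n)"
proof -
  have "(LINT x:{-L..L}|lborel. f x + g x) = (LINT x:{-L..L}|lborel. f x) + (LINT x:{-L..L}|lborel. g x)" for L
    by (intro set_integral_add continuous_set_integrable_Icc assms)
  then show ?thesis
    using tendsto_add[OF assms(1,2)[unfolded has_mean_def]]
    unfolding has_mean_def by (simp only: scaleR_right_distrib)
qed

lemma has_mean_const: "has_mean (\<lambda>\<omega>. c :: real) c"
  unfolding has_mean_def set_lebesgue_integral_def
  by (rule tendsto_eventually, rule eventually_mono[OF eventually_gt_at_top[of 0]]) simp

lemma has_mean_Re:
  assumes "has_mean f m" "continuous_on UNIV f"
  shows "has_mean (\<lambda>\<omega>. Re (f \<omega>)) (Re m)"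
proof -
  have "(LINT x:{-L..L}|lborel. Re (f x)) = Re (LINT x:{-L..L}|lborel. f x)" for L
    using integral_Re[OF continuous_set_integrable_Icc[OF assms(2), unfolded set_integrable_def]]
    by (simp add: set_lebesgue_integral_def)
  then show ?thesis using tendsto_Re[OF assms(1)[unfolded has_mean_def]]
    by (simp add: has_mean_def)
qed

lemma has_mean_cmult:
  fixes c :: real
  assumes "has_mean f m"
  shows "has_mean (\<lambda>\<omega>. c * f \<omega>) (c * m)"
proof -
  have "(1 / (2 * L)) *\<^sub>R (LINT x:{-L..L}|lborel. c * f x)
      = c * ((1 / (2 * L)) *\<^sub>R (LINT x:{-L..L}|lborel. f x))" for L
    unfolding set_integral_mult_right by simp
  then show ?thesis
    using tendsto_mult_left[OF assms[unfolded has_mean_def], of c]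
    unfolding has_mean_def by simp
qed

text \<open>
  Averaging does not increase the sup norm, so the averages of \<open>f\<close> and of a good approximant
  \<open>F n\<close> are close uniformly in \<open>L\<close>.
\<close>

lemma has_mean_uniform_limit:
  fixes f :: "real \<Rightarrow> complex"
  assumes F: "\<And>n. has_mean (F n) m" "\<And>n. continuous_on UNIV (F n)"
    and lim: "uniform_limit UNIV F f sequentially"
  shows "has_mean f m"
  unfolding has_mean_def
proof (rule tendstoI)
  fix e :: real assume "e > 0"
  have contf: "continuous_on UNIV f"
    using uniform_limit_theorem[OF _ lim] F(2) by simp
  have "\<forall>\<^sub>F n in sequentially. \<forall>\<omega>\<in>UNIV. dist (F n \<omega>) (f \<omega>) < e / 2"
    using uniform_limitD[OF lim, of "e / 2"] \<open>e > 0\<close> by simp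
  then obtain n where n: "\<And>\<omega>. dist (F n \<omega>) (f \<omega>) < e / 2"
    using eventually_happens'[OF sequentially_bot] by blast
  let ?M = "\<lambda>g L. (1 / (2 * L)) *\<^sub>R (LINT x:{-L..L}|lborel. g x)"
  have "\<forall>\<^sub>F L in at_top. dist (?M (F n) L) m < e / 2"
    using F(1)[of n] \<open>e > 0\<close> unfolding has_mean_def by (intro tendstoD) auto
  then show "\<forall>\<^sub>F L in at_top. dist (?M f L) m < e"
    using eventually_gt_at_top[of 0]
  proof eventually_elim
    case (elim L)
    have "norm (LINT x:{-L..L}|lborel. f x - F n x) \<le> 2 * L * (e / 2)"
      using n elim less_imp_le by (intro norm_integral_Icc_le continuous_intros contf F)
        (auto simp: dist_norm norm_minus_commute)
    moreover have "?M f L - ?M (F n) L = (1 / (2 * L)) *\<^sub>R (LINT x:{-L..L}|lborel. f x - F n x)"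
      by (simp add: set_integral_diff continuous_set_integrable_Icc contf F scaleR_right_diff_distrib)
    ultimately have "dist (?M f L) (?M (F n) L) \<le> e / 2"
      using elim by (simp add: dist_norm field_simps)
    with elim(1) show ?case using dist_triangle[of "?M f L" m "?M (F n) L"] by linarith
  qed
qed

lemma positive_spectrum_mean_zero: "positive_spectrum f \<Longrightarrow> has_mean f 0"
proof (induction rule: positive_spectrum.induct)
  case (exponential \<mu> c)
  then show ?case by (rule has_mean_exponential)
next
  case (add f g)
  then show ?case using has_mean_add[OF add.IH] by (simp add: positive_spectrum_continuous)
next
  case (limit F f)
  then show ?case using has_mean_uniform_limit[of F 0 f] by (simp add: positive_spectrum_continuous)
qed

section \<open>Waves and the equation on one layer\<close>

definition wave :: "real \<Rightarrow> complex \<Rightarrow> complex \<Rightarrow> real \<Rightarrow> complex" where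
  "wave \<omega> A B x = A * cis (\<omega> * x) + B * cis (- \<omega> * x)"

text \<open>
  The derivative of a wave is again a wave, so every fact about waves applies to derivatives too.
\<close>

abbreviation wave' :: "real \<Rightarrow> complex \<Rightarrow> complex \<Rightarrow> real \<Rightarrow> complex" where
  "wave' \<omega> A B \<equiv> wave \<omega> (\<i> * of_real \<omega> * A) (- \<i> * of_real \<omega> * B)"

lemma wave_has_vector_derivative:
  "(wave \<omega> A B has_vector_derivative wave' \<omega> A B x) (at x within S)"
proof -
  have "((\<lambda>x. A * cis (\<omega> * x) + B * cis (- \<omega> * x)) has_vector_derivative
      A * (\<i> * of_real \<omega> * cis (\<omega> * x)) + B * (\<i> * of_real (- \<omega>) * cis (- \<omega> * x))) (at x within S)"
    by (intro has_vector_derivative_add has_vector_derivative_mult_right cis_has_vector_derivative)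
  then show ?thesis unfolding wave_def[abs_def] by (simp add: mult_ac)
qed

lemma continuous_on_wave [continuous_intros]: "continuous_on S (wave \<omega> A B)"
  unfolding continuous_on_eq_continuous_within
  by (blast intro: has_vector_derivative_continuous wave_has_vector_derivative)

lemma wave''_eq: "wave' \<omega> (\<i> * of_real \<omega> * A) (- \<i> * of_real \<omega> * B) x = - of_real (\<omega>\<^sup>2) * wave \<omega> A B x"
  by (simp add: wave_def power2_eq_square algebra_simps)

text \<open>
  The functions \<open>e\<^bsup>-i\<mu>x\<^esup> (u' + i\<mu>u)\<close> with \<open>\<mu> = \<plusminus>\<omega>\<close> have derivative
  \<open>e\<^bsup>-i\<mu>x\<^esup> (u'' + \<mu>\<^sup>2 u) = 0\<close>, so they are constants, from which \<open>u\<close> and \<open>u'\<close> are recovered linearly.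
\<close>

lemma harmonic_ode_general_solution:
  fixes u u' :: "real \<Rightarrow> complex"
  assumes "\<omega> \<noteq> 0" "s < t"
    and u: "\<And>x. x \<in> {s<..<t} \<Longrightarrow> (u has_vector_derivative u' x) (at x)"
    and u': "\<And>x. x \<in> {s<..<t} \<Longrightarrow> (u' has_vector_derivative - of_real (\<omega>\<^sup>2) * u x) (at x)"
  obtains A B where "\<And>x. x \<in> {s<..<t} \<Longrightarrow> u x = wave \<omega> A B x \<and> u' x = wave' \<omega> A B x"
proof -
  have const: "\<exists>K. \<forall>x\<in>{s<..<t}. cis (- \<mu> * x) * (u' x + \<i> * of_real \<mu> * u x) = K"
    if "\<mu>\<^sup>2 = \<omega>\<^sup>2" for \<mu>
  proof -
    have "((\<lambda>x. cis (- \<mu> * x) * (u' x + \<i> * of_real \<mu> * u x)) has_vector_derivative 0) (at x within {s<..<t})"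
      if "x \<in> {s<..<t}" for x
    proof -
      have "((\<lambda>x. cis (- \<mu> * x) * (u' x + \<i> * of_real \<mu> * u x)) has_vector_derivative
          cis (- \<mu> * x) * (- of_real (\<omega>\<^sup>2) * u x + \<i> * of_real \<mu> * u' x)
          + \<i> * of_real (- \<mu>) * cis (- \<mu> * x) * (u' x + \<i> * of_real \<mu> * u x)) (at x)"
        by (intro has_vector_derivative_mult has_vector_derivative_add has_vector_derivative_mult_right
            cis_has_vector_derivative u u' that)
      also have "cis (- \<mu> * x) * (- of_real (\<omega>\<^sup>2) * u x + \<i> * of_real \<mu> * u' x)
          + \<i> * of_real (- \<mu>) * cis (- \<mu> * x) * (u' x + \<i> * of_real \<mu> * u x) = 0"
        unfolding \<open>\<mu>\<^sup>2 = \<omega>\<^sup>2\<close>[symmetric] by (simp add: power2_eq_square algebra_simps)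
      finally show ?thesis by (rule has_vector_derivative_at_within)
    qed
    then show ?thesis
    proof (rule has_vector_derivative_zero_constant[OF convex_real_interval(8)])
      fix K assume "\<And>x. x \<in> {s<..<t} \<Longrightarrow> cis (- \<mu> * x) * (u' x + \<i> * of_real \<mu> * u x) = K"
      then show ?thesis by blast
    qed
  qed
  from const[of \<omega>] const[of "- \<omega>"] obtain K M
    where K: "\<And>x. x \<in> {s<..<t} \<Longrightarrow> cis (- \<omega> * x) * (u' x + \<i> * of_real \<omega> * u x) = K"
      and M: "\<And>x. x \<in> {s<..<t} \<Longrightarrow> cis (\<omega> * x) * (u' x - \<i> * of_real \<omega> * u x) = M"
    by auto
  have cc: "cis (\<omega> * x) * cis (- \<omega> * x) = 1" for x by (simp add: cis_mult)
  have "u x = wave \<omega> (K / (2 * \<i> * of_real \<omega>)) (- M / (2 * \<i> * of_real \<omega>)) x \<and>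
      u' x = wave' \<omega> (K / (2 * \<i> * of_real \<omega>)) (- M / (2 * \<i> * of_real \<omega>)) x"
    if "x \<in> {s<..<t}" for x
  proof -
    have 1: "u' x + \<i> * of_real \<omega> * u x = cis (\<omega> * x) * K"
      unfolding K[OF that, symmetric] mult.assoc[symmetric] cc by simp
    have 2: "u' x - \<i> * of_real \<omega> * u x = cis (- \<omega> * x) * M"
      unfolding M[OF that, symmetric] mult.assoc[symmetric] mult.commute[of "cis (- \<omega> * x)"] cc by simp
    have "2 * (\<i> * of_real \<omega> * u x) = cis (\<omega> * x) * K - cis (- \<omega> * x) * M"
      "2 * u' x = cis (\<omega> * x) * K + cis (- \<omega> * x) * M"
      unfolding 1[symmetric] 2[symmetric] by simp_all
    then show ?thesis using \<open>\<omega> \<noteq> 0\<close> unfolding wave_def by (simp add: field_simps)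
  qed
  then show ?thesis using that by blast
qed

text \<open>
  The continuity conditions at an interface, solved for the amplitudes on its left.
\<close>

lemma wave_at_interface:
  fixes a0 a1 :: real
  defines "r \<equiv> (a0 - a1) / (a0 + a1)"
  assumes "a0 > 0" "a1 > 0" "\<omega> \<noteq> 0"
  shows "wave \<omega> A B y = wave \<omega> A' B' y \<and> a0 * wave' \<omega> A B y = a1 * wave' \<omega> A' B' y \<longleftrightarrow>
    (1 + complex_of_real r) * A = A' + r * cis (- 2 * \<omega> * y) * B' \<and> (1 + complex_of_real r) * B = r * cis (2 * \<omega> * y) * A' + B'"
    (is "?L \<longleftrightarrow> ?R")
proof -
  \<comment> \<open>The identity \<open>E F = 1\<close> is all that is needed of the phases; the rest is algebra in \<open>p, q, E, F\<close>.\<close>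
  define E F where "E = cis (\<omega> * y)" and "F = cis (- \<omega> * y)"
  have EF: "E * F = 1" by (simp add: E_def F_def cis_mult)
  then have nz: "E \<noteq> 0" "F \<noteq> 0" by auto
  have E2: "cis (2 * \<omega> * y) = E * E" and F2: "cis (- 2 * \<omega> * y) = F * F"
    by (simp_all add: E_def F_def cis_mult mult.assoc)
  define p q where "p = complex_of_real a0" and "q = complex_of_real a1"
  have s: "p + q \<noteq> 0" "p \<noteq> 0" using assms by (simp_all add: p_def q_def flip: of_real_add)
  have r: "(p + q) * of_real r = p - q" using s(1) by (simp add: r_def p_def q_def)
  have "?L \<longleftrightarrow> A * E + B * F = A' * E + B' * F \<and> p * (A * E - B * F) = q * (A' * E - B' * F)"
  proof -
    have w: "wave \<omega> A B y = A * E + B * F" for A B by (simp add: wave_def E_def F_def)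
    have "p * wave' \<omega> A B y = \<i> * of_real \<omega> * (p * (A * E - B * F))"
      "q * wave' \<omega> A' B' y = \<i> * of_real \<omega> * (q * (A' * E - B' * F))"
      by (simp_all add: w p_def q_def algebra_simps)
    then show ?thesis unfolding p_def[symmetric] q_def[symmetric] w[of A B] w[of A' B'] using \<open>\<omega> \<noteq> 0\<close> by (simp only: mult_cancel_left) simp
  qed
  also have "\<dots> \<longleftrightarrow> 2 * p * (A * E) = (p + q) * (A' * E) + (p - q) * (B' * F) \<and>
      2 * p * (B * F) = (p - q) * (A' * E) + (p + q) * (B' * F)" 
  proof safe
    assume h: "A * E + B * F = A' * E + B' * F" "p * (A * E - B * F) = q * (A' * E - B' * F)"
    then have "p * (A * E + B * F) = p * (A' * E + B' * F)" by simp
    with h(2) show "2 * p * (A * E) = (p + q) * (A' * E) + (p - q) * (B' * F)"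
      "2 * p * (B * F) = (p - q) * (A' * E) + (p + q) * (B' * F)"
      by algebra+
  next
    assume h: "2 * p * (A * E) = (p + q) * (A' * E) + (p - q) * (B' * F)"
      "2 * p * (B * F) = (p - q) * (A' * E) + (p + q) * (B' * F)"
    then have "2 * p * (A * E + B * F) = 2 * p * (A' * E + B' * F)" by algebra
    then show "A * E + B * F = A' * E + B' * F" using s(2) by simp
    from h have "2 * (p * (A * E - B * F)) = 2 * (q * (A' * E - B' * F))" by algebra
    then show "p * (A * E - B * F) = q * (A' * E - B' * F)" by simp
  qed
  also have "2 * p * (A * E) = (p + q) * (A' * E) + (p - q) * (B' * F) \<longleftrightarrow>
     (1 + complex_of_real r) * A = A' + r * cis (- 2 * \<omega> * y) * B'"
  proof -
    have "(1 + complex_of_real r) * A = A' + r * cis (- 2 * \<omega> * y) * B' \<longleftrightarrow>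
        (p + q) * E * ((1 + complex_of_real r) * A) = (p + q) * E * (A' + r * (F * F) * B')"
      unfolding F2 using s(1) nz by (simp add: mult.assoc)
    also have "(p + q) * E * ((1 + complex_of_real r) * A) = 2 * p * (A * E)"
      using r by algebra
    also have "(p + q) * E * (A' + r * (F * F) * B') =
        (p + q) * (A' * E) + (p - q) * (E * F) * (B' * F)"
      using r by algebra
    finally show ?thesis by (simp add: EF)
  qed
  also have "2 * p * (B * F) = (p - q) * (A' * E) + (p + q) * (B' * F) \<longleftrightarrow>
     (1 + complex_of_real r) * B = r * cis (2 * \<omega> * y) * A' + B'"
  proof -
    have "(1 + complex_of_real r) * B = r * cis (2 * \<omega> * y) * A' + B' \<longleftrightarrow>
        (p + q) * F * ((1 + complex_of_real r) * B) = (p + q) * F * (r * (E * E) * A' + B')"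
      unfolding E2 using s(1) nz by (simp add: mult.assoc)
    also have "(p + q) * F * ((1 + complex_of_real r) * B) = 2 * p * (B * F)"
      using r by algebra
    also have "(p + q) * F * (r * (E * E) * A' + B') =
        (p - q) * (E * F) * (A' * E) + (p + q) * (B' * F)"
      using r by algebra
    finally show ?thesis by (simp add: EF)
  qed
  finally show ?thesis .
qed

text \<open>
  Stated for functions that agree with a wave near \<open>x\<close> only, as a solution in a layered medium does.
\<close>

lemma wave_solves_ode:
  assumes "open S" "x \<in> S" "\<forall>z\<in>S. u z = wave \<omega> A B z"
  shows "u differentiable (at x)" "vector_derivative u (at x) = wave' \<omega> A B x"
    "(\<lambda>z. vector_derivative u (at z)) differentiable (at x)"
    "vector_derivative (\<lambda>z. vector_derivative u (at z)) (at x) + of_real (\<omega>\<^sup>2) * u x = 0"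
proof -
  have 1: "(u has_vector_derivative wave' \<omega> A B z) (at z)" if "z \<in> S" for z
    by (rule has_vector_derivative_transform_within_open[OF wave_has_vector_derivative assms(1) that])
      (simp add: assms(3))
  then show "u differentiable (at x)" "vector_derivative u (at x) = wave' \<omega> A B x"
    using assms(2) by (auto intro: differentiableI_vector vector_derivative_at)
  have "((\<lambda>z. vector_derivative u (at z)) has_vector_derivative
      wave' \<omega> (\<i> * of_real \<omega> * A) (- \<i> * of_real \<omega> * B) x) (at x)"
    by (rule has_vector_derivative_transform_within_open[OF wave_has_vector_derivative assms(1,2)])
      (simp add: vector_derivative_at[OF 1])
  then have "((\<lambda>z. vector_derivative u (at z)) has_vector_derivative - of_real (\<omega>\<^sup>2) * u x) (at x)"
    unfolding wave''_eq using assms(2,3) by simp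
  then show "(\<lambda>z. vector_derivative u (at z)) differentiable (at x)"
    "vector_derivative (\<lambda>z. vector_derivative u (at z)) (at x) + of_real (\<omega>\<^sup>2) * u x = 0"
    by (auto intro: differentiableI_vector simp: vector_derivative_at)
qed

lemma vector_derivative_wave_within:
  fixes b :: real
  assumes "0 < b" "x \<in> {0..b}" "0 < e" "\<And>z. z \<in> {0..b} \<Longrightarrow> dist z x < e \<Longrightarrow> u z = wave \<omega> A B z"
  shows "vector_derivative u (at x within {0..b}) = wave' \<omega> A B x"
  using assms
  by (intro vector_derivative_within_closed_interval
      has_vector_derivative_transform_within[OF wave_has_vector_derivative \<open>0 < e\<close>]) auto

text \<open>
  The boundary functionals of the scattering problem extract the right- and the left-moving part.
\<close>

lemma wave_amplitudes:
  assumes "\<omega> \<noteq> 0"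
  shows "1 / 2 * (wave \<omega> A B x + 1 / (\<i> * of_real \<omega>) * wave' \<omega> A B x) = A * cis (\<omega> * x)"
    "1 / 2 * (wave \<omega> A B x - 1 / (\<i> * of_real \<omega>) * wave' \<omega> A B x) = B * cis (- \<omega> * x)"
  using assms by (simp_all add: wave_def field_simps)

lemma eq_on_closed_interval:
  fixes f g :: "real \<Rightarrow> complex"
  assumes "s < t" "continuous_on {s..t} f" "continuous_on {s..t} g"
    "\<And>x. x \<in> {s<..<t} \<Longrightarrow> f x = g x" "x \<in> {s..t}"
  shows "f x = g x"
  using continuous_constant_on_closure[of "{s<..<t}" "\<lambda>x. f x - g x" 0 x] assms
  by (auto intro: continuous_on_diff)

section \<open>Gluing functions along the line\<close>

text \<open>
  For increasing \<open>y\<close>, the function that is \<open>w j\<close> on \<open>[y j, y (j + 1))\<close>.  Written as a sum of jumps, its continuity is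
  that of each summand, and no interval has to be singled out.
\<close>

definition glue :: "nat \<Rightarrow> (nat \<Rightarrow> real) \<Rightarrow> (nat \<Rightarrow> real \<Rightarrow> complex) \<Rightarrow> real \<Rightarrow> complex" where
  "glue d y w x = w 0 x + (\<Sum>j\<in>{1..d}. if y j \<le> x then w j x - w (j - 1) x else 0)"

lemma glue_on_piece:
  assumes "k \<le> d" "\<And>j. j \<in> {1..k} \<Longrightarrow> y j \<le> x" "\<And>j. j \<in> {k<..d} \<Longrightarrow> x < y j"
  shows "glue d y w x = w k x"
proof -
  have "(\<Sum>j\<in>{1..d}. if y j \<le> x then w j x - w (j - 1) x else 0) = (\<Sum>j\<in>{1..k}. w j x - w (j - 1) x)"
  proof (rule sum.mono_neutral_cong_right)
    show "\<forall>i\<in>{1..d} - {1..k}. (if y i \<le> x then w i x - w (i - 1) x else 0) = 0"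
      using assms(3) by (auto simp: not_le[symmetric])
  qed (use assms in auto)
  also have "\<dots> = w k x - w 0 x"
    using sum_telescope''[of 0 k "\<lambda>j. w j x"] by simp
  finally show ?thesis by (simp add: glue_def)
qed

lemma continuous_on_glue:
  assumes "\<And>j. j \<le> d \<Longrightarrow> continuous_on UNIV (w j)"
    and "\<And>j. j \<in> {1..d} \<Longrightarrow> w j (y j) = w (j - 1) (y j)"
  shows "continuous_on S (glue d y w)"
proof -
  have "continuous_on UNIV (\<lambda>x. if y j \<le> x then w j x - w (j - 1) x else 0)" if "j \<in> {1..d}" for j
  proof -
    have UN: "UNIV = {y j..} \<union> {..y j}" by auto
    show ?thesis unfolding UN using that assms
      by (intro continuous_on_cases)
        (auto intro!: continuous_on_diff intro: continuous_on_subset[of UNIV])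
  qed
  then have "continuous_on UNIV (glue d y w)"
    unfolding glue_def[abs_def] using assms(1) by (intro continuous_intros) auto
  then show ?thesis by (rule continuous_on_subset) simp
qed

section \<open>Reflection coefficients of a layered medium\<close>

text \<open>
  The conservation of energy at an interface, in terms of the reflection coefficients.
\<close>

lemma Mobius_defect:
  fixes r :: real and \<rho> :: complex
  shows "(cmod (1 + of_real r * \<rho>))\<^sup>2 - (cmod (of_real r + \<rho>))\<^sup>2 = (1 - r\<^sup>2) * (1 - (cmod \<rho>)\<^sup>2)"
  unfolding cmod_power2 by (simp add: power2_eq_square algebra_simps)

lemma one_plus_nonzero:
  fixes r :: real and \<rho> :: complex
  assumes "\<bar>r\<bar> < 1" "cmod \<rho> \<le> 1"
  shows "1 + of_real r * \<rho> \<noteq> 0"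
proof
  assume "1 + of_real r * \<rho> = 0"
  then have "of_real r * \<rho> = -1" by (simp add: add_eq_0_iff)
  then have "\<bar>r\<bar> * cmod \<rho> = 1" by (metis norm_mult norm_of_real norm_minus_cancel norm_one)
  with assms mult_left_le[of "cmod \<rho>" "\<bar>r\<bar>"] show False by simp
qed

text \<open>
  The geometry of the problem; \<open>\<omega>\<close> stays a parameter, because the spectral part treats the
  reflection coefficients as functions of \<open>\<omega>\<close>.
\<close>

locale layered_medium =
  fixes d :: nat and b :: real and y a :: "nat \<Rightarrow> real"
  assumes d_pos: "d \<ge> 1" and y1_pos: "0 < y 1" and y_mono: "strict_mono_on {1..d} y"
    and yd_less: "y d < b" and a_pos: "j \<le> d \<Longrightarrow> a j > 0"
begin

definition local_reflection :: "nat \<Rightarrow> real" where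
  "local_reflection j = (a (j - 1) - a j) / (a (j - 1) + a j)"

lemma abs_local_reflection_less: "j \<in> {1..d} \<Longrightarrow> \<bar>local_reflection j\<bar> < 1"
  using a_pos[of j] a_pos[of "j - 1", OF order.trans[OF diff_le_self]]
  unfolding local_reflection_def abs_less_iff by (auto simp: field_simps)

text \<open>
  \<open>tail_reflection j \<omega>\<close> is the quotient \<open>B\<^sub>j / A\<^sub>j\<close> of the amplitudes on layer \<open>j\<close>, for waves that
  do not come in from the right.  It depends only on the interfaces to the right of layer \<open>j\<close>,
  whence the recursion downwards from \<open>d\<close>.
\<close>

function tail_reflection :: "nat \<Rightarrow> real \<Rightarrow> complex" where
  "tail_reflection j \<omega> = (if j < d then
     (let \<rho> = cis (- 2 * \<omega> * y (Suc j)) * tail_reflection (Suc j) \<omega>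
      in cis (2 * \<omega> * y (Suc j)) * ((of_real (local_reflection (Suc j)) + \<rho>) / (1 + of_real (local_reflection (Suc j)) * \<rho>)))
     else 0)"
  by auto
termination by (relation "Wellfounded.measure (\<lambda>(j, _). d - j)") auto

declare tail_reflection.simps [simp del]

definition echo :: "nat \<Rightarrow> real \<Rightarrow> complex" where
  "echo j \<omega> = cis (- 2 * \<omega> * y j) * tail_reflection j \<omega>"

lemma tail_reflection_d [simp]: "tail_reflection d \<omega> = 0"
  by (simp add: tail_reflection.simps)

lemma tail_reflection_step:
  "j < d \<Longrightarrow> tail_reflection j \<omega> = cis (2 * \<omega> * y (Suc j)) *
     ((of_real (local_reflection (Suc j)) + echo (Suc j) \<omega>) / (1 + of_real (local_reflection (Suc j)) * echo (Suc j) \<omega>))"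
  by (subst tail_reflection.simps) (simp add: echo_def Let_def)

text \<open>
  The defect identity shows that \<open>\<rho> \<mapsto> (r + \<rho>) / (1 + r \<rho>)\<close> maps the open unit disc into itself, and
  phase factors do not change the modulus.
\<close>

lemma norm_tail_reflection_less: "j \<le> d \<Longrightarrow> cmod (tail_reflection j \<omega>) < 1"
proof (induction j rule: inc_induct)
  case (step j)
  let ?r = "local_reflection (Suc j)" and ?\<rho> = "echo (Suc j) \<omega>"
  have r: "\<bar>?r\<bar> < 1" using step by (intro abs_local_reflection_less) auto
  have \<rho>: "cmod ?\<rho> < 1" using step by (simp add: echo_def norm_mult)
  have "0 < (1 - ?r\<^sup>2) * (1 - (cmod ?\<rho>)\<^sup>2)"
    using r \<rho> by (intro mult_pos_pos) (simp_all add: abs_square_less_1)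
  then have "cmod (of_real ?r + ?\<rho>) < cmod (1 + of_real ?r * ?\<rho>)"
    unfolding Mobius_defect[symmetric] by (simp add: power2_less_imp_less)
  moreover have "1 + of_real ?r * ?\<rho> \<noteq> 0" using r \<rho> by (intro one_plus_nonzero) auto
  ultimately show ?case using step(2) by (simp add: tail_reflection_step norm_mult norm_divide)
qed simp

lemma norm_echo_less: "j \<le> d \<Longrightarrow> cmod (echo j \<omega>) < 1"
  using norm_tail_reflection_less by (simp add: echo_def norm_mult)

lemma echo_denominator_nonzero: "j \<in> {1..d} \<Longrightarrow> 1 + of_real (local_reflection j) * echo j \<omega> \<noteq> 0"
  using norm_echo_less[of j \<omega>] by (intro one_plus_nonzero abs_local_reflection_less) auto

lemma y_less: "1 \<le> i \<Longrightarrow> i < j \<Longrightarrow> j \<le> d \<Longrightarrow> y i < y j"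
  using y_mono by (auto simp: strict_mono_on_def)

text \<open>
  Here positivity of the frequencies arises: passing from \<open>y\<^sub>j\<^sub>+\<^sub>1\<close> to \<open>y\<^sub>j\<close> multiplies by
  \<open>e\<^bsup>i\<mu>\<omega>\<^esup>\<close> with \<open>\<mu> = 2 (y\<^sub>j\<^sub>+\<^sub>1 - y\<^sub>j) > 0\<close>, the travel time across the layer and back.  This also lifts the
  constant term \<open>r\<^sub>j\<^sub>+\<^sub>1\<close> to a positive frequency.
\<close>

lemma positive_spectrum_echo:
  assumes "j \<in> {1..d}"
  shows "positive_spectrum (echo j)"
proof -
  have "1 \<le> j \<longrightarrow> positive_spectrum (echo j)" if "j \<le> d" for j
    using that
  proof (induction j rule: inc_induct)
    case base
    show ?case by (simp add: echo_def[abs_def] positive_spectrum_0)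
  next
    case (step j)
    show ?case
    proof
      assume "1 \<le> j"
      let ?r = "local_reflection (Suc j)" and ?\<rho> = "echo (Suc j)" and ?\<mu> = "2 * (y (Suc j) - y j)"
      have "?\<mu> > 0" using y_less[of j "Suc j"] step \<open>1 \<le> j\<close> by simp
      have r: "\<bar>?r\<bar> < 1" using step by (intro abs_local_reflection_less) auto
      have \<rho>: "cmod (?\<rho> \<omega>) \<le> 1" for \<omega> using norm_echo_less[of "Suc j" \<omega>] step by simp
      have "echo j \<omega> = of_real ?r * cis (?\<mu> * \<omega>)
          + of_real (1 - ?r\<^sup>2) * cis (?\<mu> * \<omega>) * (?\<rho> \<omega> / (1 + of_real ?r * ?\<rho> \<omega>))" for \<omega>
      proof -
        have nz: "1 + of_real ?r * ?\<rho> \<omega> \<noteq> 0" using r \<rho> by (rule one_plus_nonzero)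
        have "cis (- 2 * \<omega> * y j) * cis (2 * \<omega> * y (Suc j)) = cis (?\<mu> * \<omega>)"
          by (simp add: cis_mult algebra_simps)
        moreover have "(of_real ?r + ?\<rho> \<omega>) / (1 + of_real ?r * ?\<rho> \<omega>)
            = of_real ?r + of_real (1 - ?r\<^sup>2) * (?\<rho> \<omega> / (1 + of_real ?r * ?\<rho> \<omega>))"
          using nz by (simp add: divide_simps) (simp add: algebra_simps power2_eq_square)
        ultimately show ?thesis
          using step(2) by (simp add: echo_def[of j] tail_reflection_step mult.assoc[symmetric])
            (simp add: algebra_simps)
      qed
      then have eq: "echo j = (\<lambda>\<omega>. of_real ?r * cis (?\<mu> * \<omega>)
          + of_real (1 - ?r\<^sup>2) * cis (?\<mu> * \<omega>) * (?\<rho> \<omega> / (1 + of_real ?r * ?\<rho> \<omega>)))" by blast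
      show "positive_spectrum (echo j)"
        unfolding eq using \<open>?\<mu> > 0\<close> step
        by (intro positive_spectrum.add positive_spectrum.exponential positive_spectrum_modulate
            positive_spectrum_Mobius \<rho> r) auto
    qed
  qed
  then show ?thesis using assms by simp
qed

text \<open>
  The defect identity, telescoped from layer \<open>d\<close>, where nothing is reflected, down to layer \<open>0\<close>.
\<close>

lemma transmission_product:
  "1 - (cmod (tail_reflection 0 \<omega>))\<^sup>2
    = (\<Prod>j=1..d. (1 - (local_reflection j)\<^sup>2) / (cmod (1 + of_real (local_reflection j) * echo j \<omega>))\<^sup>2)"
proof -
  have "1 - (cmod (tail_reflection k \<omega>))\<^sup>2
    = (\<Prod>j\<in>{k<..d}. (1 - (local_reflection j)\<^sup>2) / (cmod (1 + of_real (local_reflection j) * echo j \<omega>))\<^sup>2)" if "k \<le> d" for k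
    using that
  proof (induction k rule: inc_induct)
    case (step k)
    let ?r = "local_reflection (Suc k)" and ?\<rho> = "echo (Suc k) \<omega>"
    have nz: "1 + of_real ?r * ?\<rho> \<noteq> 0" using step by (intro echo_denominator_nonzero) auto
    have "1 - (cmod (tail_reflection k \<omega>))\<^sup>2
        = ((cmod (1 + of_real ?r * ?\<rho>))\<^sup>2 - (cmod (of_real ?r + ?\<rho>))\<^sup>2) / (cmod (1 + of_real ?r * ?\<rho>))\<^sup>2"
      using nz step(2) by (simp add: tail_reflection_step norm_mult norm_divide power_divide diff_divide_distrib)
    also have "\<dots> = (1 - ?r\<^sup>2) / (cmod (1 + of_real ?r * ?\<rho>))\<^sup>2 * (1 - (cmod (tail_reflection (Suc k) \<omega>))\<^sup>2)"
      by (simp add: Mobius_defect echo_def norm_mult)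
    also have "{k<..d} = insert (Suc k) {Suc k<..d}" using step by auto
    ultimately show ?case by (simp add: step.IH)
  qed simp
  from this[of 0] show ?thesis by (simp add: atLeastSucAtMost_greaterThanAtMost)
qed

text \<open>
  The principal branch of the logarithm serves only to write \<open>ln |z|\<close> as the real part of a function
  with positive spectrum.
\<close>

lemma log_transmission:
  "ln (1 - (cmod (tail_reflection 0 \<omega>))\<^sup>2)
    = (\<Sum>j=1..d. ln (1 - (local_reflection j)\<^sup>2)) + (- 2) * Re (\<Sum>j=1..d. Ln (1 + of_real (local_reflection j) * echo j \<omega>))"
proof -
  have pos: "0 < 1 - (local_reflection j)\<^sup>2" if "j \<in> {1..d}" for j
    using abs_local_reflection_less[OF that] by (simp add: abs_square_less_1)
  have "ln (1 - (cmod (tail_reflection 0 \<omega>))\<^sup>2)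
      = (\<Sum>j=1..d. ln ((1 - (local_reflection j)\<^sup>2) / (cmod (1 + of_real (local_reflection j) * echo j \<omega>))\<^sup>2))"
    unfolding transmission_product
  proof (intro ln_prod finite_atLeastAtMost)
    fix j assume j: "j \<in> {1..d}"
    show "(1 - (local_reflection j)\<^sup>2) / (cmod (1 + of_real (local_reflection j) * echo j \<omega>))\<^sup>2 \<noteq> 0"
      using pos[OF j] echo_denominator_nonzero[OF j, of \<omega>] by simp
  qed
  also have "\<dots> = (\<Sum>j=1..d. ln (1 - (local_reflection j)\<^sup>2) - 2 * Re (Ln (1 + of_real (local_reflection j) * echo j \<omega>)))"
  proof (rule sum.cong)
    fix j assume j: "j \<in> {1..d}"
    show "ln ((1 - (local_reflection j)\<^sup>2) / (cmod (1 + of_real (local_reflection j) * echo j \<omega>))\<^sup>2)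
        = ln (1 - (local_reflection j)\<^sup>2) - 2 * Re (Ln (1 + of_real (local_reflection j) * echo j \<omega>))"
      using pos[OF j] echo_denominator_nonzero[OF j, of \<omega>] by (simp add: ln_div ln_realpow)
  qed simp
  finally show ?thesis by (simp add: sum_subtractf flip: sum_distrib_left)
qed

lemma positive_spectrum_log_denominators:
  "positive_spectrum (\<lambda>\<omega>. \<Sum>j=1..d. Ln (1 + of_real (local_reflection j) * echo j \<omega>))"
  using norm_echo_less less_imp_le
  by (intro positive_spectrum_sum positive_spectrum_Ln positive_spectrum_echo abs_local_reflection_less) auto

lemma continuous_on_log_transmission:
  "continuous_on UNIV (\<lambda>\<omega>. ln (1 - (cmod (tail_reflection 0 \<omega>))\<^sup>2))"
  unfolding log_transmission
  by (intro continuous_on_add continuous_on_mult continuous_on_const continuous_on_Re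
      positive_spectrum_continuous positive_spectrum_log_denominators)

lemma has_mean_log_transmission:
  "has_mean (\<lambda>\<omega>. ln (1 - (cmod (tail_reflection 0 \<omega>))\<^sup>2)) (\<Sum>j=1..d. ln (1 - (local_reflection j)\<^sup>2))"
proof -
  have "has_mean (\<lambda>\<omega>. (\<Sum>j=1..d. ln (1 - (local_reflection j)\<^sup>2))
      + (- 2) * Re (\<Sum>j=1..d. Ln (1 + of_real (local_reflection j) * echo j \<omega>)))
      ((\<Sum>j=1..d. ln (1 - (local_reflection j)\<^sup>2)) + (- 2) * Re 0)"
    by (intro has_mean_add has_mean_const has_mean_cmult has_mean_Re continuous_on_mult
        continuous_on_const continuous_on_Re positive_spectrum_mean_zero
        positive_spectrum_continuous positive_spectrum_log_denominators)
  then show ?thesis by (simp only: log_transmission) simp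
qed

end

section \<open>The scattering solution\<close>

context layered_medium
begin

text \<open>
  The interfaces together with the end points \<open>0\<close> and \<open>b\<close>, so that layer \<open>k\<close> is
  \<open>[node k, node (k + 1)]\<close> for all \<open>k \<le> d\<close>.
\<close>

definition node :: "nat \<Rightarrow> real" where
  "node k = (if k = 0 then 0 else if k \<le> d then y k else b)"

lemma node_simps [simp]: "node 0 = 0" "1 \<le> k \<Longrightarrow> k \<le> d \<Longrightarrow> node k = y k" "node (Suc d) = b"
  by (simp_all add: node_def)

lemma y_mono_le: "1 \<le> i \<Longrightarrow> i \<le> j \<Longrightarrow> j \<le> d \<Longrightarrow> y i \<le> y j"
  using y_less[of i j] by (cases "i = j") auto

lemma y_pos: "1 \<le> j \<Longrightarrow> j \<le> d \<Longrightarrow> 0 < y j"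
  using y_mono_le[of 1 j] y1_pos by simp

lemma y_less_b: "1 \<le> j \<Longrightarrow> j \<le> d \<Longrightarrow> y j < b"
  using y_mono_le[of j d] yd_less by simp

lemma b_pos: "0 < b"
  using y_pos[of d] yd_less d_pos by simp

lemma node_less: "k \<le> d \<Longrightarrow> node k < node (Suc k)"
  using y_less[of k "Suc k"] b_pos y_less_b[of k] y1_pos d_pos
  by (auto simp: node_def Suc_le_eq)

lemma node_bounds: "0 \<le> node k" "node k \<le> b"
  using y_pos[of k] y_less_b[of k] b_pos by (auto simp: node_def intro: less_imp_le)

text \<open>
  This form, over all interfaces, is the one that evaluates sums over interfaces.
\<close>

definition in_layer :: "nat \<Rightarrow> real \<Rightarrow> bool" where
  "in_layer k x \<longleftrightarrow> k \<le> d \<and> (\<forall>j\<in>{1..k}. y j \<le> x) \<and> (\<forall>j\<in>{k<..d}. x < y j)"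

lemma in_layer_iff:
  "in_layer k x \<longleftrightarrow> k \<le> d \<and> (k = 0 \<or> y k \<le> x) \<and> (k = d \<or> x < y (Suc k))"
proof
  assume "in_layer k x"
  then show "k \<le> d \<and> (k = 0 \<or> y k \<le> x) \<and> (k = d \<or> x < y (Suc k))"
    by (cases "k = 0"; cases "k = d") (auto simp: in_layer_def)
next
  assume R: "k \<le> d \<and> (k = 0 \<or> y k \<le> x) \<and> (k = d \<or> x < y (Suc k))"
  have "y j \<le> x" if "j \<in> {1..k}" for j using R that y_mono_le[of j k] by auto
  moreover have "x < y j" if "j \<in> {k<..d}" for j using R that y_mono_le[of "Suc k" j] by auto
  ultimately show "in_layer k x" using R by (auto simp: in_layer_def)
qed

lemma in_layer_exists: "\<exists>k. in_layer k x"
proof -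
  define k where "k = Max {k\<in>{0..d}. k = 0 \<or> y k \<le> x}"
  have "k \<in> {k\<in>{0..d}. k = 0 \<or> y k \<le> x}"
    unfolding k_def by (rule Max_in) auto
  moreover have "x < y (Suc k)" if "k < d"
  proof (rule ccontr)
    assume "\<not> x < y (Suc k)"
    then have "Suc k \<in> {k\<in>{0..d}. k = 0 \<or> y k \<le> x}" using that by auto
    then have "Suc k \<le> k" unfolding k_def by (intro Max_ge) auto
    then show False by simp
  qed
  ultimately have "in_layer k x" unfolding in_layer_iff by (auto simp: le_less)
  then show ?thesis ..
qed

lemma in_layer_node: "k \<le> d \<Longrightarrow> x \<in> {node k..<node (Suc k)} \<Longrightarrow> in_layer k x"
  by (auto simp: in_layer_iff node_def split: if_splits)

lemma node_in_layer: "in_layer k x \<Longrightarrow> x \<in> {0..b} \<Longrightarrow> x \<in> {node k..node (Suc k)}"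
  by (auto simp: in_layer_iff node_def split: if_splits)

lemma step_impedance_in_layer:
  assumes "in_layer k x"
  shows "step_impedance d y a x = a k"
proof -
  have k: "k \<le> d" "\<And>j. 1 \<le> j \<Longrightarrow> j \<le> k \<Longrightarrow> y j \<le> x" "\<And>j. k < j \<Longrightarrow> j \<le> d \<Longrightarrow> x < y j"
    using assms by (auto simp: in_layer_def)
  have "indicat_real {y j..<y (j + 1)} x = (if j = k then 1 else 0)" if "j \<in> {1..<d}" for j
    using that k(2)[of j] k(2)[of "j + 1"] k(3)[of j] k(3)[of "j + 1"]
    by (cases j k rule: linorder_cases) (auto simp: indicator_def)
  then have "(\<Sum>j\<in>{1..<d}. a j * indicat_real {y j..<y (j + 1)} x) = (\<Sum>j\<in>{1..<d}. if j = k then a j else 0)"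
    by (intro sum.cong) auto
  also have "\<dots> = (if 1 \<le> k \<and> k < d then a k else 0)" by simp
  finally have "(\<Sum>j\<in>{1..<d}. a j * indicat_real {y j..<y (j + 1)} x) = (if 1 \<le> k \<and> k < d then a k else 0)" .
  moreover have "indicat_real {..<y 1} x = (if k = 0 then 1 else 0)"
    using k(2)[of 1] k(3)[of 1] d_pos by (auto simp: indicator_def)
  moreover have "indicat_real {y d..} x = (if k = d then 1 else 0)"
    using k(2)[of d] k(3)[of d] k(1) d_pos by (auto simp: indicator_def)
  ultimately show ?thesis
    unfolding step_impedance_def using k(1) d_pos by (simp only:) (cases "k = 0"; auto)
qed

text \<open>
  Continuity of \<open>u\<close> and of \<open>\<zeta> u'\<close> at every interface.
\<close>

definition matched :: "real \<Rightarrow> (nat \<Rightarrow> complex) \<Rightarrow> (nat \<Rightarrow> complex) \<Rightarrow> bool" where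
  "matched \<omega> A B \<longleftrightarrow> (\<forall>j<d.
     wave \<omega> (A j) (B j) (y (Suc j)) = wave \<omega> (A (Suc j)) (B (Suc j)) (y (Suc j)) \<and>
     a j * wave' \<omega> (A j) (B j) (y (Suc j)) = a (Suc j) * wave' \<omega> (A (Suc j)) (B (Suc j)) (y (Suc j)))"

lemma matched_iff:
  assumes "\<omega> \<noteq> 0"
  shows "matched \<omega> A B \<longleftrightarrow> (\<forall>j<d.
    (1 + complex_of_real (local_reflection (Suc j))) * A j
      = A (Suc j) + local_reflection (Suc j) * cis (- 2 * \<omega> * y (Suc j)) * B (Suc j) \<and>
    (1 + complex_of_real (local_reflection (Suc j))) * B j
      = local_reflection (Suc j) * cis (2 * \<omega> * y (Suc j)) * A (Suc j) + B (Suc j))"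
proof -
  have "(wave \<omega> (A j) (B j) (y (Suc j)) = wave \<omega> (A (Suc j)) (B (Suc j)) (y (Suc j)) \<and>
     a j * wave' \<omega> (A j) (B j) (y (Suc j)) = a (Suc j) * wave' \<omega> (A (Suc j)) (B (Suc j)) (y (Suc j)))
   \<longleftrightarrow> ((1 + complex_of_real (local_reflection (Suc j))) * A j
      = A (Suc j) + local_reflection (Suc j) * cis (- 2 * \<omega> * y (Suc j)) * B (Suc j) \<and>
    (1 + complex_of_real (local_reflection (Suc j))) * B j
      = local_reflection (Suc j) * cis (2 * \<omega> * y (Suc j)) * A (Suc j) + B (Suc j))" if "j < d" for j
    using wave_at_interface[of "a j" "a (Suc j)" \<omega>] a_pos[of j] a_pos[of "Suc j"] that assms
    by (simp add: local_reflection_def)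
  then show ?thesis unfolding matched_def by blast
qed

text \<open>
  The amplitudes \<open>A\<^sub>k\<close> and, in the next definition, \<open>B\<^sub>k\<close> of the scattering solution, normalised by
  \<open>A\<^sub>0 = 1\<close>; the \<open>j\<close>-th factor is \<open>A\<^sub>j / A\<^sub>j\<^sub>-\<^sub>1\<close>.
\<close>

definition transmitted :: "nat \<Rightarrow> real \<Rightarrow> complex" where
  "transmitted k \<omega> = (\<Prod>j=1..k. (1 + of_real (local_reflection j)) / (1 + of_real (local_reflection j) * echo j \<omega>))"

definition reflected :: "nat \<Rightarrow> real \<Rightarrow> complex" where
  "reflected k \<omega> = tail_reflection k \<omega> * transmitted k \<omega>"

text \<open>
  With \<open>B' = G\<^sub>j\<^sub>+\<^sub>1 A'\<close> known from the right, the interface conditions determine \<open>A'\<close> and \<open>B\<close> from \<open>A\<close>.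
  As an equivalence this serves both uniqueness and existence of the amplitudes.
\<close>

lemma interface_step:
  assumes "j < d" "B' = tail_reflection (Suc j) \<omega> * A'"
  shows "(1 + complex_of_real (local_reflection (Suc j))) * A
      = A' + local_reflection (Suc j) * cis (- 2 * \<omega> * y (Suc j)) * B' \<and>
    (1 + complex_of_real (local_reflection (Suc j))) * B
      = local_reflection (Suc j) * cis (2 * \<omega> * y (Suc j)) * A' + B' \<longleftrightarrow>
    A' = A * ((1 + of_real (local_reflection (Suc j))) / (1 + of_real (local_reflection (Suc j)) * echo (Suc j) \<omega>)) \<and>
    B = tail_reflection j \<omega> * A"
proof -
  let ?r = "complex_of_real (local_reflection (Suc j))" and ?\<rho> = "echo (Suc j) \<omega>"
  let ?E = "cis (2 * \<omega> * y (Suc j))" and ?F = "cis (- 2 * \<omega> * y (Suc j))"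
  have nz: "1 + ?r * ?\<rho> \<noteq> 0" using assms by (intro echo_denominator_nonzero) auto
  have r: "1 + ?r \<noteq> 0"
    using abs_local_reflection_less[of "Suc j"] assms one_plus_nonzero[of "local_reflection (Suc j)" 1] by simp
  have EF: "?E * ?F = 1" by (simp add: cis_mult)
  have B': "B' = ?E * ?\<rho> * A'"
    using EF by (simp add: assms(2) echo_def mult.assoc[symmetric])
  have "(1 + ?r) * A = A' + ?r * ?F * B' \<longleftrightarrow> (1 + ?r) * A = (1 + ?r * ?\<rho>) * A'"
    unfolding B' using EF by (simp add: algebra_simps)
  also have "\<dots> \<longleftrightarrow> A' = A * ((1 + ?r) / (1 + ?r * ?\<rho>))"
    using nz by (auto simp: field_simps)
  finally have A: "(1 + ?r) * A = A' + ?r * ?F * B' \<longleftrightarrow> A' = A * ((1 + ?r) / (1 + ?r * ?\<rho>))" .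
  \<comment> \<open>Given the value of \<open>A'\<close>, the second condition is the recursion for \<open>tail_reflection\<close>.\<close>
  have "(1 + ?r) * B = ?r * ?E * A' + B' \<longleftrightarrow> B = tail_reflection j \<omega> * A"
    if "A' = A * ((1 + ?r) / (1 + ?r * ?\<rho>))"
  proof -
    have "?r * ?E * A' + B' = (1 + ?r) * (tail_reflection j \<omega> * A)"
      unfolding B' that tail_reflection_step[OF assms(1)] using nz by (simp add: divide_simps) (simp add: algebra_simps)
    then show ?thesis using r by simp
  qed
  with A show ?thesis by blast
qed

text \<open>
  The ratios \<open>B\<^sub>j / A\<^sub>j\<close> are found from right to left, beginning with \<open>B\<^sub>d = 0\<close>; then the \<open>A\<^sub>j\<close> from left
  to right, beginning with \<open>A\<^sub>0 = 1\<close>.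
\<close>

lemma matched_unique:
  assumes "\<omega> \<noteq> 0" "matched \<omega> A B" "A 0 = 1" "B d = 0" "k \<le> d"
  shows "A k = transmitted k \<omega>" "B k = reflected k \<omega>"
proof -
  have B: "B j = tail_reflection j \<omega> * A j" if "j \<le> d" for j
    using that
  proof (induction j rule: inc_induct)
    case (step j)
    then show ?case using interface_step[of j "B (Suc j)" \<omega> "A (Suc j)" "A j" "B j"] assms(2)
      unfolding matched_iff[OF assms(1)] by blast
  qed (simp add: assms)
  have A: "A j = transmitted j \<omega>" if "j \<le> d" for j
    using that
  proof (induction j)
    case (Suc j)
    then have "A (Suc j) = A j * ((1 + of_real (local_reflection (Suc j)))
        / (1 + of_real (local_reflection (Suc j)) * echo (Suc j) \<omega>))"
      using interface_step[of j "B (Suc j)" \<omega> "A (Suc j)" "A j" "B j"] assms(2) B[of "Suc j"]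
      unfolding matched_iff[OF assms(1)] by (meson Suc_le_lessD)
    then show ?case using Suc by (simp add: transmitted_def)
  qed (simp add: transmitted_def assms)
  show "A k = transmitted k \<omega>" "B k = reflected k \<omega>"
    using A B assms(5) by (simp_all add: reflected_def)
qed

text \<open>
  Existence of amplitudes that satisfy all interface conditions, the counterpart of \<open>matched_unique\<close>.
\<close>

lemma matched_transmitted_reflected:
  assumes "\<omega> \<noteq> 0"
  shows "matched \<omega> (\<lambda>k. transmitted k \<omega>) (\<lambda>k. reflected k \<omega>)"
  unfolding matched_iff[OF assms]
proof (intro allI impI)
  fix j assume "j < d"
  show "(1 + complex_of_real (local_reflection (Suc j))) * transmitted j \<omega>
      = transmitted (Suc j) \<omega> + local_reflection (Suc j) * cis (- 2 * \<omega> * y (Suc j)) * reflected (Suc j) \<omega> \<and>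
    (1 + complex_of_real (local_reflection (Suc j))) * reflected j \<omega>
      = local_reflection (Suc j) * cis (2 * \<omega> * y (Suc j)) * transmitted (Suc j) \<omega> + reflected (Suc j) \<omega>"
    unfolding interface_step[OF \<open>j < d\<close> reflected_def] by (simp add: transmitted_def reflected_def)
qed

definition layered_wave :: "real \<Rightarrow> real \<Rightarrow> complex" where
  "layered_wave \<omega> = glue d y (\<lambda>k. wave \<omega> (transmitted k \<omega>) (reflected k \<omega>))"

text \<open>
  The continuous extension of \<open>\<zeta> u'\<close> that the notion of weak solution asks for.
\<close>

definition layered_flux :: "real \<Rightarrow> real \<Rightarrow> complex" where
  "layered_flux \<omega> = glue d y (\<lambda>k x. a k * wave' \<omega> (transmitted k \<omega>) (reflected k \<omega>) x)"

lemma layered_wave_in_layer: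
  "in_layer k x \<Longrightarrow> layered_wave \<omega> x = wave \<omega> (transmitted k \<omega>) (reflected k \<omega>) x"
  unfolding layered_wave_def in_layer_def by (subst glue_on_piece) auto

lemma layered_flux_in_layer:
  "in_layer k x \<Longrightarrow> layered_flux \<omega> x = a k * wave' \<omega> (transmitted k \<omega>) (reflected k \<omega>) x"
  unfolding layered_flux_def in_layer_def by (subst glue_on_piece) auto

lemma matchedD:
  assumes "matched \<omega> A B" "j \<in> {1..d}"
  shows "wave \<omega> (A j) (B j) (y j) = wave \<omega> (A (j - 1)) (B (j - 1)) (y j)"
    "a j * wave' \<omega> (A j) (B j) (y j) = a (j - 1) * wave' \<omega> (A (j - 1)) (B (j - 1)) (y j)"
  using assms unfolding matched_def by (cases j; simp)+

lemma continuous_on_layered: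
  assumes "\<omega> \<noteq> 0"
  shows "continuous_on S (layered_wave \<omega>)" "continuous_on S (layered_flux \<omega>)"
  unfolding layered_wave_def layered_flux_def
  using matchedD[OF matched_transmitted_reflected[OF assms]]
  by (auto intro!: continuous_on_glue continuous_intros)

text \<open>
  An interval on which \<open>\<zeta>\<close> is constant may still contain an interface \<open>y\<^sub>k\<close>, namely one with
  \<open>a\<^sub>k\<^sub>-\<^sub>1 = a\<^sub>k\<close>.  Then \<open>r\<^sub>k = 0\<close> and the amplitudes do not change at \<open>y\<^sub>k\<close>, so that the solution is a single
  wave on both sides of \<open>y\<^sub>k\<close>.
\<close>

lemma layered_wave_locally_wave:
  assumes "\<omega> \<noteq> 0" "step_impedance d y a constant_on {s<..<t}" "x \<in> {s<..<t}"
  obtains k S where "k \<le> d" "in_layer k x" "open S" "x \<in> S" "S \<subseteq> {s<..<t}"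
    "\<And>z. z \<in> S \<Longrightarrow> layered_wave \<omega> z = wave \<omega> (transmitted k \<omega>) (reflected k \<omega>) z"
proof -
  obtain k where k: "in_layer k x" using in_layer_exists by blast
  then have "k \<le> d" by (simp add: in_layer_def)
  define hi where "hi = (if k = d then t else min t (y (Suc k)))"
  have hi: "x < hi" "hi \<le> t" using k assms(3) by (auto simp: hi_def in_layer_iff)
  show ?thesis
  proof (cases "k = 0 \<or> y k < x")
    case True
    define lo where "lo = (if k = 0 then s else max s (y k))"
    have lo: "lo < x" "s \<le> lo" using True assms(3) by (auto simp: lo_def)
    have "in_layer k z" if "z \<in> {lo<..<hi}" for z
      using that k unfolding in_layer_iff by (auto simp: lo_def hi_def split: if_splits)
    then have "layered_wave \<omega> z = wave \<omega> (transmitted k \<omega>) (reflected k \<omega>) z" if "z \<in> {lo<..<hi}" for z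
      using layered_wave_in_layer that by blast
    moreover have "{lo<..<hi} \<subseteq> {s<..<t}" using lo hi by auto
    ultimately show ?thesis using that[of k "{lo<..<hi}"] k lo hi \<open>k \<le> d\<close> by auto
  next
    case False
    then have "1 \<le> k" "y k = x" using k by (auto simp: in_layer_iff)
    define lo where "lo = (if k = 1 then s else max s (y (k - 1)))"
    have lo: "lo < x" "s \<le> lo"
      using \<open>1 \<le> k\<close> \<open>y k = x\<close> y_less[of "k - 1" k] \<open>k \<le> d\<close> assms(3) by (auto simp: lo_def)
    have below: "in_layer (k - 1) z" if "lo < z" "z < x" for z
      using that \<open>1 \<le> k\<close> \<open>k \<le> d\<close> \<open>y k = x\<close> unfolding in_layer_iff by (auto simp: lo_def split: if_splits)
    have above: "in_layer k z" if "x \<le> z" "z < hi" for z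
      using that k unfolding in_layer_iff by (auto simp: hi_def split: if_splits)
    obtain z where z: "lo < z" "z < x" using dense[OF lo(1)] by blast
    have "step_impedance d y a z = step_impedance d y a x"
      using assms(2,3) z lo unfolding constant_on_def by auto
    then have "a (k - 1) = a k"
      using step_impedance_in_layer[OF below[OF z]] step_impedance_in_layer[OF k] by simp
    \<comment> \<open>The interface at \<open>x = y k\<close> is invisible: equal impedances on both sides.\<close>
    then have "local_reflection k = 0" by (simp add: local_reflection_def)
    then have "transmitted (k - 1) \<omega> = transmitted k \<omega>" "reflected (k - 1) \<omega> = reflected k \<omega>"
      using matched_transmitted_reflected[OF assms(1)] \<open>1 \<le> k\<close> \<open>k \<le> d\<close>
      unfolding matched_iff[OF assms(1)] by (auto dest!: spec[of _ "k - 1"])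
    then have "layered_wave \<omega> z = wave \<omega> (transmitted k \<omega>) (reflected k \<omega>) z" if "z \<in> {lo<..<hi}" for z
      using that layered_wave_in_layer[OF above[of z]] layered_wave_in_layer[OF below[of z]]
      by (cases "x \<le> z") auto
    moreover have "{lo<..<hi} \<subseteq> {s<..<t}" using lo hi by auto
    ultimately show ?thesis using that[of k "{lo<..<hi}"] k lo hi \<open>k \<le> d\<close> by auto
  qed
qed

lemma impedance_solution_layered_wave:
  assumes "\<omega> \<noteq> 0"
  shows "impedance_solution b (step_impedance d y a) \<omega> (restrict (layered_wave \<omega>) {0..b})"
    (is "impedance_solution _ _ _ ?u")
  unfolding impedance_solution_def
proof (intro conjI exI[of _ "layered_flux \<omega>"] allI impI ballI continuous_on_layered assms)
  show "continuous_on {0..b} ?u"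
    using continuous_on_layered(1)[OF assms] by (subst continuous_on_cong[OF refl, of _ _ "layered_wave \<omega>"]) auto
  fix s t x assume st: "0 \<le> s \<and> s < t \<and> t \<le> b \<and> step_impedance d y a constant_on {s<..<t}" and x: "x \<in> {s<..<t}"
  obtain k S where k: "k \<le> d" "in_layer k x" and S: "open S" "x \<in> S" "S \<subseteq> {s<..<t}"
    "\<And>z. z \<in> S \<Longrightarrow> layered_wave \<omega> z = wave \<omega> (transmitted k \<omega>) (reflected k \<omega>) z"
    using layered_wave_locally_wave[OF assms _ x] st by blast
  have u: "\<forall>z\<in>S. ?u z = wave \<omega> (transmitted k \<omega>) (reflected k \<omega>) z"
    using S(3,4) st by fastforce
  note w = wave_solves_ode[OF S(1,2) u]
  show "?u differentiable (at x)" "(\<lambda>z. vector_derivative ?u (at z)) differentiable (at x)"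
    "vector_derivative (\<lambda>z. vector_derivative ?u (at z)) (at x) + of_real (\<omega>\<^sup>2) * ?u x = 0"
    by (rule w(1) w(3) w(4))+
  show "layered_flux \<omega> x = of_real (step_impedance d y a x) * vector_derivative ?u (at x)"
    unfolding w(2) layered_flux_in_layer[OF k(2)] step_impedance_in_layer[OF k(2)] ..
qed

text \<open>
  On the interior of each layer the equation is solved explicitly; continuity of \<open>u\<close> and of the flux
  extends the formulas to the closed layers, where neighbouring ones can be compared.
\<close>

lemma impedance_solution_is_layered:
  assumes "\<omega> \<noteq> 0" "impedance_solution b (step_impedance d y a) \<omega> u"
  obtains A B where "matched \<omega> A B"
    "\<forall>k\<le>d. \<forall>x\<in>{node k..node (Suc k)}. u x = wave \<omega> (A k) (B k) x"
proof -
  let ?\<zeta> = "step_impedance d y a"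
  from assms(2) obtain p where cont: "continuous_on {0..b} u" "continuous_on {0..b} p"
    and ode: "\<And>s t x. 0 \<le> s \<Longrightarrow> s < t \<Longrightarrow> t \<le> b \<Longrightarrow> ?\<zeta> constant_on {s<..<t} \<Longrightarrow> x \<in> {s<..<t} \<Longrightarrow>
            u differentiable (at x) \<and>
            p x = of_real (?\<zeta> x) * vector_derivative u (at x) \<and>
            (\<lambda>z. vector_derivative u (at z)) differentiable (at x) \<and>
            vector_derivative (\<lambda>z. vector_derivative u (at z)) (at x) + of_real (\<omega>\<^sup>2) * u x = 0"
    unfolding impedance_solution_def by blast
  have "\<exists>A B. \<forall>x\<in>{node k..node (Suc k)}. u x = wave \<omega> A B x \<and> p x = a k * wave' \<omega> A B x"
    if k: "k \<le> d" for k
  proof -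
    let ?I = "{node k<..<node (Suc k)}"
    have \<zeta>: "?\<zeta> x = a k" if "x \<in> ?I" for x
      using in_layer_node[OF k, of x] that by (intro step_impedance_in_layer) auto
    then have "?\<zeta> constant_on ?I" by (auto simp: constant_on_def)
    note o = ode[OF node_bounds(1) node_less[OF k] node_bounds(2) this]
    obtain A B where AB: "\<And>x. x \<in> ?I \<Longrightarrow> u x = wave \<omega> A B x \<and> vector_derivative u (at x) = wave' \<omega> A B x"
    proof (rule harmonic_ode_general_solution[OF assms(1) node_less[OF k]])
      fix x assume x: "x \<in> ?I"
      show "(u has_vector_derivative vector_derivative u (at x)) (at x)"
        using o[OF x] by (simp add: vector_derivative_works)
      have "vector_derivative (\<lambda>z. vector_derivative u (at z)) (at x) = - of_real (\<omega>\<^sup>2) * u x"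
        using o[OF x] by (simp add: eq_neg_iff_add_eq_0)
      then show "((\<lambda>z. vector_derivative u (at z)) has_vector_derivative - of_real (\<omega>\<^sup>2) * u x) (at x)"
        using o[OF x] by (metis vector_derivative_works)
    qed blast
    have sub: "{node k..node (Suc k)} \<subseteq> {0..b}" using node_bounds[of k] node_bounds[of "Suc k"] by auto
    have "u x = wave \<omega> A B x" "p x = a k * wave' \<omega> A B x" if x: "x \<in> {node k..node (Suc k)}" for x
    proof -
      show "u x = wave \<omega> A B x"
        by (rule eq_on_closed_interval[OF node_less[OF k] _ _ _ x])
          (use AB continuous_on_subset[OF cont(1) sub] in \<open>auto intro: continuous_intros\<close>)
      show "p x = a k * wave' \<omega> A B x"
        by (rule eq_on_closed_interval[OF node_less[OF k] _ _ _ x])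
          (use AB o \<zeta> continuous_on_subset[OF cont(2) sub] in \<open>auto intro: continuous_intros\<close>)
    qed
    then show ?thesis by blast
  qed
  then obtain A B where AB: "\<And>k x. k \<le> d \<Longrightarrow> x \<in> {node k..node (Suc k)} \<Longrightarrow>
      u x = wave \<omega> (A k) (B k) x \<and> p x = a k * wave' \<omega> (A k) (B k) x"
    by metis
  have "matched \<omega> A B"
    unfolding matched_def
  proof (intro allI impI)
    fix j assume "j < d"
    then have "y (Suc j) \<in> {node j..node (Suc j)}" "y (Suc j) \<in> {node (Suc j)..node (Suc (Suc j))}"
      using node_less[of j] node_less[of "Suc j"] by auto
    from AB[OF _ this(1)] AB[OF _ this(2)] \<open>j < d\<close>
    show "wave \<omega> (A j) (B j) (y (Suc j)) = wave \<omega> (A (Suc j)) (B (Suc j)) (y (Suc j)) \<and>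
     a j * wave' \<omega> (A j) (B j) (y (Suc j)) = a (Suc j) * wave' \<omega> (A (Suc j)) (B (Suc j)) (y (Suc j))"
      by simp
  qed
  with AB that show ?thesis by blast
qed

lemma boundary_amplitudes:
  assumes "\<omega> \<noteq> 0" and u: "\<forall>k\<le>d. \<forall>x\<in>{node k..node (Suc k)}. u x = wave \<omega> (A k) (B k) x"
  shows "1 / 2 * (u 0 + 1 / (\<i> * of_real \<omega>) * vector_derivative u (at 0 within {0..b})) = A 0"
    "1 / 2 * (u 0 - 1 / (\<i> * of_real \<omega>) * vector_derivative u (at 0 within {0..b})) = B 0"
    "1 / 2 * (u b - 1 / (\<i> * of_real \<omega>) * vector_derivative u (at b within {0..b})) = B d * cis (- \<omega> * b)"
proof -
  have "u 0 = wave \<omega> (A 0) (B 0) 0" using u node_less[of 0] by simp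
  moreover have "vector_derivative u (at 0 within {0..b}) = wave' \<omega> (A 0) (B 0) 0"
    by (rule vector_derivative_wave_within[of b 0 "node 1"])
      (use b_pos node_less[of 0] u[rule_format, of 0] in \<open>auto simp: dist_real_def\<close>)
  ultimately show "1 / 2 * (u 0 + 1 / (\<i> * of_real \<omega>) * vector_derivative u (at 0 within {0..b})) = A 0"
    "1 / 2 * (u 0 - 1 / (\<i> * of_real \<omega>) * vector_derivative u (at 0 within {0..b})) = B 0"
    using wave_amplitudes[OF assms(1), of _ _ 0] by simp_all
  have "u b = wave \<omega> (A d) (B d) b" using u[rule_format, of d b] node_less[of d] by simp
  moreover have "vector_derivative u (at b within {0..b}) = wave' \<omega> (A d) (B d) b"
    by (rule vector_derivative_wave_within[of b b "b - node d"])
      (use b_pos node_less[of d] u[rule_format, of d] in \<open>auto simp: dist_real_def\<close>)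
  ultimately show "1 / 2 * (u b - 1 / (\<i> * of_real \<omega>) * vector_derivative u (at b within {0..b})) = B d * cis (- \<omega> * b)"
    using wave_amplitudes(2)[OF assms(1)] by simp
qed

lemma layered_wave_node:
  assumes "\<omega> \<noteq> 0" "k \<le> d" "x \<in> {node k..node (Suc k)}"
  shows "layered_wave \<omega> x = wave \<omega> (transmitted k \<omega>) (reflected k \<omega>) x"
proof (rule eq_on_closed_interval[OF node_less[OF assms(2)] _ _ _ assms(3)])
  show "layered_wave \<omega> z = wave \<omega> (transmitted k \<omega>) (reflected k \<omega>) z"
    if "z \<in> {node k<..<node (Suc k)}" for z
    using that by (intro layered_wave_in_layer in_layer_node assms(2)) simp
qed (intro continuous_on_layered(1) continuous_on_wave assms(1))+

lemma restrict_layered_wave_node: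
  assumes "\<omega> \<noteq> 0"
  shows "\<forall>k\<le>d. \<forall>x\<in>{node k..node (Suc k)}.
    restrict (layered_wave \<omega>) {0..b} x = wave \<omega> (transmitted k \<omega>) (reflected k \<omega>) x"
proof (intro allI impI ballI)
  fix k x assume "k \<le> d" and x: "x \<in> {node k..node (Suc k)}"
  moreover have "x \<in> {0..b}" using x node_bounds[of k] node_bounds[of "Suc k"] by auto
  ultimately show "restrict (layered_wave \<omega>) {0..b} x = wave \<omega> (transmitted k \<omega>) (reflected k \<omega>) x"
    using layered_wave_node[OF assms] by simp
qed

lemma scattering_solution_eq:
  assumes "\<omega> \<noteq> 0"
  shows "scattering_solution b (step_impedance d y a) \<omega> = restrict (layered_wave \<omega>) {0..b}"
  unfolding scattering_solution_def
proof (rule the_equality)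
  let ?u = "restrict (layered_wave \<omega>) {0..b}"
  note bc = boundary_amplitudes[OF assms, of ?u "\<lambda>k. transmitted k \<omega>" "\<lambda>k. reflected k \<omega>",
      OF restrict_layered_wave_node[OF assms]]
  show "?u \<in> extensional {0..b} \<and> impedance_solution b (step_impedance d y a) \<omega> ?u \<and>
        1 / 2 * (?u 0 + 1 / (\<i> * of_real \<omega>) * vector_derivative ?u (at 0 within {0..b})) = 1 \<and>
        1 / 2 * (?u b - 1 / (\<i> * of_real \<omega>) * vector_derivative ?u (at b within {0..b})) = 0"
    unfolding bc using impedance_solution_layered_wave[OF assms]
    by (auto simp: transmitted_def reflected_def)
next
  fix u assume u: "u \<in> extensional {0..b} \<and> impedance_solution b (step_impedance d y a) \<omega> u \<and>
        1 / 2 * (u 0 + 1 / (\<i> * of_real \<omega>) * vector_derivative u (at 0 within {0..b})) = 1 \<and>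
        1 / 2 * (u b - 1 / (\<i> * of_real \<omega>) * vector_derivative u (at b within {0..b})) = 0"
  then obtain A B where m: "matched \<omega> A B"
    and AB: "\<forall>k\<le>d. \<forall>x\<in>{node k..node (Suc k)}. u x = wave \<omega> (A k) (B k) x"
    using impedance_solution_is_layered[OF assms] by metis
  have "A 0 = 1" "B d = 0" using u unfolding boundary_amplitudes[OF assms AB] by auto
  note c = matched_unique[OF assms m this]
  show "u = restrict (layered_wave \<omega>) {0..b}"
  proof (rule extensionalityI[of _ "{0..b}"])
    fix x assume x: "x \<in> {0..b}"
    obtain k where k: "in_layer k x" using in_layer_exists by blast
    then have "k \<le> d" by (simp add: in_layer_def)
    then show "u x = restrict (layered_wave \<omega>) {0..b} x"
      using AB[rule_format, OF _ node_in_layer[OF k x]] c[of k] layered_wave_in_layer[OF k] x by simp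
  qed (use u in auto)
qed

lemma reflection_coefficient_eq:
  assumes "\<omega> \<noteq> 0"
  shows "reflection_coefficient b (step_impedance d y a) \<omega> = tail_reflection 0 \<omega>"
proof -
  let ?u = "restrict (layered_wave \<omega>) {0..b}"
  from boundary_amplitudes(2)[OF assms, of ?u "\<lambda>k. transmitted k \<omega>" "\<lambda>k. reflected k \<omega>",
      OF restrict_layered_wave_node[OF assms]] show ?thesis
    unfolding reflection_coefficient_def scattering_solution_eq[OF assms] Let_def
    by (simp add: reflected_def transmitted_def)
qed

end

section \<open>The mean of the logarithm of the transmitted energy\<close>

theorem theorem6:
  fixes d :: nat and b :: real and y a r :: "nat \<Rightarrow> real" and R :: "real \<Rightarrow> complex"
  assumes "d \<ge> 1" and "b > 0"
    and "0 < y 1" and "strict_mono_on {1..d} y" and "y d < b"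
    and "\<forall>j\<in>{0..d}. a j > 0"
    and "\<forall>\<omega>. \<omega> \<noteq> 0 \<longrightarrow> R \<omega> = reflection_coefficient b (step_impedance d y a) \<omega>"
    and "\<forall>j\<in>{1..d}. r j = (a (j - 1) - a j) / (a (j - 1) + a j)"
  shows "((\<lambda>L. 1 / (2 * L) * (LINT \<omega>:{-L..L}|lborel. ln (1 - (cmod (R \<omega>))\<^sup>2)))
            \<longlongrightarrow> (\<Sum>j=1..d. ln (1 - \<bar>r j\<bar>\<^sup>2))) at_top"
proof -
  interpret layered_medium d b y a
    using assms by unfold_locales auto
  define h where "h \<omega> = ln (1 - (cmod (tail_reflection 0 \<omega>))\<^sup>2)" for \<omega>
  have R: "R \<omega> = tail_reflection 0 \<omega>" if "\<omega> \<noteq> 0" for \<omega>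
    using assms(7) reflection_coefficient_eq[OF that] that by simp
  have h [measurable]: "h \<in> borel_measurable borel"
    unfolding h_def[abs_def] by (rule borel_measurable_continuous_onI[OF continuous_on_log_transmission])
  \<comment> \<open>\<open>R\<close> is arbitrary at \<open>\<omega> = 0\<close>, a null set.\<close>
  define c where "c = ln (1 - (cmod (R 0))\<^sup>2)"
  have eq: "(\<lambda>\<omega>. ln (1 - (cmod (R \<omega>))\<^sup>2)) = (\<lambda>\<omega>. if \<omega> = 0 then c else h \<omega>)"
    by (auto simp: c_def h_def R)
  have "(LINT \<omega>:{-L..L}|lborel. ln (1 - (cmod (R \<omega>))\<^sup>2)) = (LINT \<omega>:{-L..L}|lborel. h \<omega>)" for L
    unfolding eq set_lebesgue_integral_def
  proof (rule integral_cong_AE)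
    show "AE \<omega> in lborel. indicat_real {-L..L} \<omega> *\<^sub>R (if \<omega> = 0 then c else h \<omega>) = indicat_real {-L..L} \<omega> *\<^sub>R h \<omega>"
      using AE_lborel_singleton[of 0] by eventually_elim simp
  qed measurable
  moreover have "(\<Sum>j=1..d. ln (1 - \<bar>r j\<bar>\<^sup>2)) = (\<Sum>j=1..d. ln (1 - (local_reflection j)\<^sup>2))"
    using assms(8) unfolding power2_abs by (intro sum.cong) (auto simp: local_reflection_def)
  ultimately show ?thesis
    using has_mean_log_transmission unfolding has_mean_def h_def[symmetric] by simp
qed

end
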